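(* Let $m$ be a positive integer, $\vec c=(c_1,\dots,c_m)$ with $c_j>0$ for all $j$, and let $S_{\vec c}\subset E^m$ be the product of spheres defined in the context. Let $\vec u\in B_{\vec c}\subset S_{\vec c}$, let $U$ be a neighborhood of $\vec u$ in $S_{\vec c}$, and suppose $B_{\vec c}\cap\overline U$ is closed in $S_{\vec c}$. Let $V:\overline U\to E^m$ be a Lipschitz mapping with $V(\vec w)\in T_{\vec w}S_{\vec c}$ for every $\vec w\in\overline U$, satisfying $$\lim_{s\searrow0}s^{-1}\,\mathrm{dist}(\vec w+sV(\vec w),B_{\vec c})=0\qquad\text{for all }\vec w\in\overline U\cap B_{\vec c}.$$ Then there exist $r=r(\vec u)>0$ and $\eta(\cdot,\vec u)$ satisfying $$\frac{\partial}{\partial t}\eta(t,\vec u)=V(\eta(t,\vec u))\ \ \forall t\in[0,r),\qquad \eta(0,\vec u)=\vec u,\qquad \eta(t,\vec u)\in B_{\vec c}\ \ \forall t\in[0,r).$$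
   Context: $(E,\langle\cdot,\cdot\rangle)$ and $(H,(\cdot,\cdot))$ are two infinite-dimensional real Hilbert spaces with $E\hookrightarrow H\hookrightarrow E'$ with continuous injections; the injection $E\hookrightarrow H$ has norm at most $1$ and $E$ is identified with its image in $H$. For $u\in E$ write $\|u\|^2=\langle u,u\rangle$ and $|u|^2=(u,u)$. Define $$S_{\vec c}=\{\vec u=(u_1,\dots,u_m)\in E^m:\ |u_j|^2=c_j,\ j=1,\dots,m\},$$ $$T_{\vec w}S_{\vec c}=\{\vec\phi=(\phi_1,\dots,\phi_m)\in E^m:\ (\phi_1,w_1)=\dots=(\phi_m,w_m)=0\}.$$ Distances, Lipschitz continuity and topology on $E^m$ and $S_{\vec c}$ are with respect to the product norm of $E^m$. *)

theory Defs
  imports "HOL-Analysis.Analysis"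
begin

definition infinite_dimensional :: "'a::real_vector itself \<Rightarrow> bool" where
  "infinite_dimensional _ \<longleftrightarrow> \<not> (\<exists>B :: 'a set. finite B \<and> span B = UNIV)"

(* The map from H to the dual E' sends h to the functional e \<mapsto> (h, \<iota> e).  It is linear and
   bounded whenever \<iota> is, so only its injectivity (density of \<iota>(E) in H) is a condition. *)
definition dual_embedding :: "('e::real_normed_vector \<Rightarrow>\<^sub>L 'h::real_inner) \<Rightarrow> 'h \<Rightarrow> ('e \<Rightarrow>\<^sub>L real)" where
  "dual_embedding \<iota> h = blinfun_inner_right h o\<^sub>L \<iota>"

definition hilbert_triple ::
  "('e::{real_inner,complete_space} \<Rightarrow>\<^sub>L 'h::{real_inner,complete_space}) \<Rightarrow> bool" where
  "hilbert_triple \<iota> \<longleftrightarrow>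
     infinite_dimensional TYPE('e) \<and> infinite_dimensional TYPE('h) \<and>
     inj (blinfun_apply \<iota>) \<and> norm \<iota> \<le> 1 \<and> inj (dual_embedding \<iota>)"

(* E^m is rendered as 'e ^ 'm with m = CARD('m) \<ge> 1; its norm is the Euclidean product norm. *)
definition sphere_product ::
  "('e::real_normed_vector \<Rightarrow>\<^sub>L 'h::real_inner) \<Rightarrow> real ^ 'm \<Rightarrow> ('e ^ 'm) set" where
  "sphere_product \<iota> c = {u. \<forall>j. (norm (\<iota> (u $ j)))\<^sup>2 = c $ j}"

definition tangent_space ::
  "('e::real_normed_vector \<Rightarrow>\<^sub>L 'h::real_inner) \<Rightarrow> 'e ^ 'm \<Rightarrow> ('e ^ 'm) set" where
  "tangent_space \<iota> w = {\<phi>. \<forall>j. \<iota> (\<phi> $ j) \<bullet> \<iota> (w $ j) = 0}"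

end

theory Submission
  imports Defs
begin

text \<open>
  This is Nagumo's invariance theorem for a complete subset of a normed space.
  Starting at a point of the set, one makes Euler steps whose end points are corrected to lie in
  the set, each step being at least half as long as admissible. If the step times accumulated early,
  the nodes would converge to a point of the set, and the subtangency condition there would allow a
  step of fixed length from all late nodes, which is absurd. Comparing two such polygons through
  the one-sided growth of the norm of their difference, the polygons are uniformly Cauchy, and
  comparing one polygon with a straight line shows that the limit solves the equation.
\<close>

section \<open>One-sided growth of real functions\<close>

text \<open>The times in \<open>{a..t}\<close> at which the bound holds form a compact set
  containing \<open>a\<close>; at its largest element \<open>m < t\<close> the growth condition
  would produce a larger one. Growth is demanded only at times where the bound already holds, so a
  bound can be used to prove itself.\<close>

lemma growth_bound_of_right_growth:
  fixes f :: "real \<Rightarrow> real"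
  assumes cont: "continuous_on {a..b} f"
    and growth: "\<And>t. a \<le> t \<Longrightarrow> t < b \<Longrightarrow> f t \<le> f a + C * (t - a) \<Longrightarrow>
      \<forall>\<^sub>F s in at_right 0. f (t + s) \<le> f t + C * s"
    and t: "a \<le> t" "t \<le> b"
  shows "f t \<le> f a + C * (t - a)"
proof (rule ccontr)
  assume neg: "\<not> ?thesis"
  define g where "g s = f s - (f a + C * (s - a))" for s
  have cg: "continuous_on {a..t} g"
    unfolding g_def using t by (intro continuous_intros continuous_on_subset[OF cont]) auto
  define S where "S = {s \<in> {a..t}. g s \<le> 0}"
  have "closed S"
    unfolding S_def using continuous_closed_preimage[OF cg, of "{..0}"]
    by (simp add: vimage_def Int_def)
  moreover have "bounded S"
    by (rule bounded_subset[of "{a..t}"]) (auto simp: S_def)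
  ultimately have "compact S"
    by (simp add: compact_eq_bounded_closed)
  moreover have "a \<in> S"
    using t by (simp add: S_def g_def)
  ultimately obtain m where m: "m \<in> S" "\<And>s. s \<in> S \<Longrightarrow> s \<le> m"
    using compact_attains_sup[of S] by blast
  have "m \<noteq> t"
    using m(1) neg by (auto simp: S_def g_def)
  hence mt: "a \<le> m" "m < t" "g m \<le> 0"
    using m(1) by (auto simp: S_def)
  have "\<forall>\<^sub>F s in at_right 0. f (m + s) \<le> f m + C * s"
    using mt t by (intro growth) (auto simp: g_def)
  moreover have "\<forall>\<^sub>F s in at_right 0. s \<in> {0<..<t - m}"
    using mt by (intro eventually_at_right_real) auto
  ultimately have "\<forall>\<^sub>F s in at_right (0::real). m + s \<in> S \<and> s > 0"
  proof eventually_elim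
    case (elim s)
    thus ?case using mt by (auto simp: S_def g_def algebra_simps)
  qed
  then obtain s where "m + s \<in> S" "s > 0"
    using eventually_happens by fastforce
  with m(2)[of "m + s"] show False by simp
qed

section \<open>Approximate solutions and their comparison\<close>

text \<open>The point \<open>w\<close> is the last node of the polygon before time \<open>t\<close>, and \<open>v\<close> its current slope.\<close>

definition approx_solution ::
  "('a::real_normed_vector \<Rightarrow> 'a) \<Rightarrow> 'a set \<Rightarrow> real \<Rightarrow> real \<Rightarrow> (real \<Rightarrow> 'a) \<Rightarrow> bool" where
  "approx_solution V D r e p \<longleftrightarrow> continuous_on {0..r} p \<and>
     (\<forall>t\<in>{0..<r}. \<exists>w\<in>D. \<exists>v. norm (p t - w) \<le> e \<and> norm (v - V w) \<le> e \<and>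
        (\<forall>\<^sub>F s in at_right 0. p (t + s) = p t + s *\<^sub>R v))"

lemma approx_solutionE:
  assumes "approx_solution V D r e p" "0 \<le> t" "t < r"
  obtains w v where "w \<in> D" "norm (p t - w) \<le> e" "norm (v - V w) \<le> e"
    "\<forall>\<^sub>F s in at_right 0. p (t + s) = p t + s *\<^sub>R v"
proof -
  have "t \<in> {0..<r}"
    using assms(2,3) by simp
  then show ?thesis
    using assms(1) that unfolding approx_solution_def by blast
qed

lemma approx_solution_continuous: "approx_solution V D r e p \<Longrightarrow> continuous_on {0..r} p"
  by (simp add: approx_solution_def)

text \<open>With \<open>A = (1 + L) * (e + d)\<close>, the slopes at time \<tau> differ by at most
  \<open>A + L * f \<tau>\<close>, where \<open>f\<close> is the norm of the difference. As long as
  \<open>f \<tau> \<le> 2 * A * \<tau>\<close>, the condition \<open>L * r \<le> 1/2\<close> makes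
  this at most \<open>2 * A\<close>, so the linear bound sustains itself. Shortness of the time
  interval thus takes the place of an exponential Gronwall factor.\<close>

lemma approx_solutions_close:
  assumes p: "approx_solution V D r e p" and q: "approx_solution V D r d q"
    and L: "L-lipschitz_on D V" "L * r \<le> 1/2"
    and init: "p 0 = q 0" and nonneg: "e \<ge> 0" "d \<ge> 0"
    and t: "0 \<le> t" "t \<le> r"
  shows "norm (p t - q t) \<le> 2 * (1 + L) * (e + d) * t"
proof -
  have L0: "L \<ge> 0"
    using L(1) by (rule lipschitz_on_nonneg)
  define A where "A = (1 + L) * (e + d)"
  have A0: "A \<ge> 0"
    using L0 nonneg by (simp add: A_def)
  define f where "f t = norm (p t - q t)" for t
  have "f t \<le> f 0 + 2 * A * (t - 0)"
  proof (rule growth_bound_of_right_growth[where b = r])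
    show "continuous_on {0..r} f"
      unfolding f_def
      by (intro continuous_intros approx_solution_continuous[OF p] approx_solution_continuous[OF q])
    fix \<tau> assume \<tau>: "0 \<le> \<tau>" "\<tau> < r" and f\<tau>: "f \<tau> \<le> f 0 + 2 * A * (\<tau> - 0)"
    obtain w v where w: "w \<in> D" "norm (p \<tau> - w) \<le> e" "norm (v - V w) \<le> e"
      "\<forall>\<^sub>F s in at_right 0. p (\<tau> + s) = p \<tau> + s *\<^sub>R v"
      using approx_solutionE[OF p \<tau>] by blast
    obtain w' v' where w': "w' \<in> D" "norm (q \<tau> - w') \<le> d" "norm (v' - V w') \<le> d"
      "\<forall>\<^sub>F s in at_right 0. q (\<tau> + s) = q \<tau> + s *\<^sub>R v'"
      using approx_solutionE[OF q \<tau>] by blast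
    have "norm (w - w') \<le> norm (p \<tau> - w) + norm (p \<tau> - q \<tau>) + norm (q \<tau> - w')"
      by (smt (verit) norm_triangle_ineq4 norm_minus_commute diff_add_cancel norm_triangle_sub
          add_diff_eq norm_diff_triangle_le)
    also have "\<dots> \<le> f \<tau> + (e + d)"
      using w w' by (simp add: f_def)
    finally have ww: "norm (w - w') \<le> f \<tau> + (e + d)" .
    have "norm (v - v') \<le> norm (v - V w) + norm (V w - V w') + norm (v' - V w')"
      by (smt (verit) norm_minus_commute norm_diff_triangle_le)
    also have "norm (V w - V w') \<le> L * norm (w - w')"
      using lipschitz_onD[OF L(1) w(1) w'(1)] by (simp add: dist_norm)
    also have "L * norm (w - w') \<le> L * (f \<tau> + (e + d))"
      using ww L0 by (rule mult_left_mono)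
    finally have "norm (v - v') \<le> A + L * f \<tau>"
      using w(3) w'(3) by (simp add: A_def algebra_simps)
    also have "L * f \<tau> \<le> L * (2 * A * \<tau>)"
      using f\<tau> L0 init by (intro mult_left_mono) (auto simp: f_def)
    also have "\<dots> = 2 * A * (L * \<tau>)"
      by simp
    also have "\<dots> \<le> 2 * A * (1/2)"
    proof (intro mult_left_mono)
      have "L * \<tau> \<le> L * r"
        using \<tau> L0 by (intro mult_left_mono) auto
      with L(2) show "L * \<tau> \<le> 1/2" by simp
    qed (use A0 in auto)
    finally have vv: "norm (v - v') \<le> 2 * A" by simp
    show "\<forall>\<^sub>F s in at_right 0. f (\<tau> + s) \<le> f \<tau> + 2 * A * s"
      using w(4) w'(4) eventually_at_right_less[of 0]
    proof eventually_elim
      case (elim s)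
      have "f (\<tau> + s) = norm ((p \<tau> - q \<tau>) + s *\<^sub>R (v - v'))"
        using elim by (simp add: f_def algebra_simps)
      also have "\<dots> \<le> f \<tau> + s * norm (v - v')"
        using norm_triangle_ineq[of "p \<tau> - q \<tau>" "s *\<^sub>R (v - v')"] elim by (simp add: f_def)
      also have "s * norm (v - v') \<le> s * (2 * A)"
        using vv elim by (intro mult_left_mono) auto
      finally show ?case by (simp add: mult.commute)
    qed
  qed (use t in auto)
  then show ?thesis
    using init by (simp add: f_def A_def algebra_simps)
qed

text \<open>The current node is within \<open>e + \<delta>\<close> of \<open>z\<close>, so by the
  Lipschitz condition every slope on the interval is within \<open>e + L * (e + \<delta>)\<close> of
  \<open>V z\<close>. Below, \<open>z = u\<close> yields a common Lipschitz constant for all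
  polygons, and \<open>z = \<eta> t\<close> yields the derivative.\<close>

lemma approx_solution_near_line:
  assumes p: "approx_solution V D r e p"
    and L: "L-lipschitz_on D V" and z: "z \<in> D"
    and ab: "0 \<le> a" "a \<le> b" "b \<le> r"
    and near: "\<And>\<tau>. a \<le> \<tau> \<Longrightarrow> \<tau> < b \<Longrightarrow> norm (p \<tau> - z) \<le> \<delta>"
  shows "norm (p b - p a - (b - a) *\<^sub>R V z) \<le> (e + L * (e + \<delta>)) * (b - a)"
proof -
  have L0: "L \<ge> 0"
    using L by (rule lipschitz_on_nonneg)
  define f where "f t = norm (p t - p a - (t - a) *\<^sub>R V z)" for t
  have "f b \<le> f a + (e + L * (e + \<delta>)) * (b - a)"
  proof (rule growth_bound_of_right_growth[where b = b])
    show "continuous_on {a..b} f"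
      unfolding f_def using ab
      by (intro continuous_intros continuous_on_subset[OF approx_solution_continuous[OF p]]) auto
    fix \<tau> assume \<tau>: "a \<le> \<tau>" "\<tau> < b"
    then have \<tau>': "0 \<le> \<tau>" "\<tau> < r"
      using ab by auto
    obtain w v where w: "w \<in> D" "norm (p \<tau> - w) \<le> e" "norm (v - V w) \<le> e"
      "\<forall>\<^sub>F s in at_right 0. p (\<tau> + s) = p \<tau> + s *\<^sub>R v"
      using approx_solutionE[OF p \<tau>'] by blast
    have "norm (w - z) \<le> e + \<delta>"
      by (rule norm_diff_triangle_le[of _ "p \<tau>"]) (use w near[OF \<tau>] in \<open>auto simp: norm_minus_commute\<close>)
    then have "norm (V w - V z) \<le> L * (e + \<delta>)"
      using lipschitz_onD[OF L w(1) z] L0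
      by (smt (verit) dist_norm mult_left_mono)
    with w(3) have vv: "norm (v - V z) \<le> e + L * (e + \<delta>)"
      by (rule norm_diff_triangle_le)
    show "\<forall>\<^sub>F s in at_right 0. f (\<tau> + s) \<le> f \<tau> + (e + L * (e + \<delta>)) * s"
      using w(4) eventually_at_right_less[of 0]
    proof eventually_elim
      case (elim s)
      have "f (\<tau> + s) = norm ((p \<tau> - p a - (\<tau> - a) *\<^sub>R V z) + s *\<^sub>R (v - V z))"
        using elim by (simp add: f_def algebra_simps)
      also have "\<dots> \<le> f \<tau> + s * norm (v - V z)"
        using norm_triangle_ineq[of "p \<tau> - p a - (\<tau> - a) *\<^sub>R V z" "s *\<^sub>R (v - V z)"] elim
        by (simp add: f_def)
      also have "s * norm (v - V z) \<le> s * (e + L * (e + \<delta>))"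
        using vv elim by (intro mult_left_mono) auto
      finally show ?case by (simp add: mult.commute)
    qed
  qed (use ab in auto)
  then show ?thesis
    by (simp add: f_def)
qed

section \<open>Polygons through given nodes\<close>

text \<open>The summand \<open>k\<close> is the displacement along the \<open>k\<close>-th segment up to time \<open>\<tau>\<close>.\<close>

definition polygon :: "(nat \<Rightarrow> real) \<Rightarrow> (nat \<Rightarrow> 'a::real_normed_vector) \<Rightarrow> nat \<Rightarrow> real \<Rightarrow> 'a" where
  "polygon t w n \<tau> = w 0 + (\<Sum>k<n. max 0 (min (\<tau> - t k) (t (Suc k) - t k)) *\<^sub>R
     ((w (Suc k) - w k) /\<^sub>R (t (Suc k) - t k)))"

lemma continuous_on_polygon: "continuous_on S (polygon t w n)"
  unfolding polygon_def by (intro continuous_intros)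

text \<open>At a time in segment \<open>k\<close> the earlier summands are saturated and telescope
  to \<open>w k - w 0\<close>, while the later ones are clamped to zero.\<close>

lemma polygon_segment:
  assumes t: "strict_mono t" and k: "k < n" and \<tau>: "t k \<le> \<tau>" "\<tau> \<le> t (Suc k)"
  shows "polygon t w n \<tau> = w k + (\<tau> - t k) *\<^sub>R ((w (Suc k) - w k) /\<^sub>R (t (Suc k) - t k))"
proof -
  define T where "T j = max 0 (min (\<tau> - t j) (t (Suc j) - t j)) *\<^sub>R
     ((w (Suc j) - w j) /\<^sub>R (t (Suc j) - t j))" for j
  have mono: "i \<le> j \<Longrightarrow> t i \<le> t j" for i j
    using strict_mono_less_eq[OF t] by simp
  have pos: "t j < t (Suc j)" for j
    using t by (simp add: strict_mono_Suc_iff)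
  have before: "T j = w (Suc j) - w j" if "j < k" for j
  proof -
    have "max 0 (min (\<tau> - t j) (t (Suc j) - t j)) = t (Suc j) - t j"
      using pos[of j] mono[of "Suc j" k] that \<tau> by simp
    then show ?thesis
      using pos[of j] by (simp add: T_def)
  qed
  have after: "T j = 0" if "k < j" for j
    using pos[of j] mono[of "Suc k" j] that \<tau> by (simp add: T_def min_def max_def)
  have "sum T {..<n} = sum T {..<k} + sum T {k..<n}"
    using k sum.atLeastLessThan_concat[of 0 k n T] by (simp add: atLeast0LessThan)
  also have "sum T {k..<n} = T k + sum T {Suc k..<n}"
    using k by (rule sum.atLeast_Suc_lessThan)
  also have "sum T {..<k} = w k - w 0"
    using before by (simp add: sum_lessThan_telescope)
  also have "sum T {Suc k..<n} = 0"
    using after by simp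
  finally show ?thesis
    using \<tau> by (simp add: polygon_def T_def)
qed

lemma polygon_start: "strict_mono t \<Longrightarrow> 0 < n \<Longrightarrow> polygon t w n (t 0) = w 0"
  using polygon_segment[of t 0 n "t 0" w] by (simp add: strict_mono_less_eq)

lemma polygon_approx_solution:
  assumes t: "strict_mono t" "t 0 = 0" "r \<le> t n"
    and w: "\<And>k. k < n \<Longrightarrow> w k \<in> D"
    and step: "\<And>k. k < n \<Longrightarrow> norm (w (Suc k) - w k - (t (Suc k) - t k) *\<^sub>R V (w k)) \<le> e * (t (Suc k) - t k)"
    and len: "\<And>k. k < n \<Longrightarrow> norm (w (Suc k) - w k) \<le> e"
  shows "approx_solution V D r e (polygon t w n)"
  unfolding approx_solution_def
proof (intro conjI ballI)
  show "continuous_on {0..r} (polygon t w n)"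
    by (rule continuous_on_polygon)
  fix \<tau> assume \<tau>: "\<tau> \<in> {0..<r}"
  \<comment> \<open>The index of the segment with \<open>t k \<le> \<tau> < t (Suc k)\<close>.
    Strictness on the right leaves room for small positive \<open>s\<close> in the same segment,
    also when \<tau> is itself a node time.\<close>
  define k where "k = (LEAST k. \<tau> < t (Suc k))"
  have n0: "n > 0"
    using t \<tau> by (cases n) auto
  then have ex: "\<tau> < t (Suc (n - 1))"
    using t \<tau> by simp
  have k: "\<tau> < t (Suc k)"
    unfolding k_def using ex by (rule LeastI)
  have kn: "k < n"
    using Least_le[of "\<lambda>k. \<tau> < t (Suc k)", OF ex] n0 by (simp add: k_def)
  have k': "t k \<le> \<tau>"
  proof (cases k)
    case 0
    then show ?thesis using t \<tau> by simp
  next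
    case (Suc j)
    then show ?thesis
      using not_less_Least[of j "\<lambda>k. \<tau> < t (Suc k)"] by (simp add: k_def)
  qed
  define h where "h = t (Suc k) - t k"
  have h: "h > 0"
    using k k' by (simp add: h_def)
  define v where "v = (w (Suc k) - w k) /\<^sub>R h"
  have seg: "polygon t w n s = w k + (s - t k) *\<^sub>R v" if "t k \<le> s" "s \<le> t (Suc k)" for s
    using polygon_segment[OF t(1) kn that] by (simp add: v_def h_def)
  have "norm (polygon t w n \<tau> - w k) \<le> e"
  proof -
    have "norm (polygon t w n \<tau> - w k) = (\<tau> - t k) / h * norm (w (Suc k) - w k)"
      using seg[of \<tau>] k k' h by (simp add: v_def divide_inverse)
    also have "\<dots> \<le> 1 * norm (w (Suc k) - w k)"
      using k k' h by (intro mult_right_mono) (auto simp: h_def field_simps)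
    finally show ?thesis using len[OF kn] by simp
  qed
  moreover have "norm (v - V (w k)) \<le> e"
  proof -
    have "v - V (w k) = (w (Suc k) - w k - h *\<^sub>R V (w k)) /\<^sub>R h"
      using h by (simp add: v_def scaleR_diff_right)
    then have "norm (v - V (w k)) = norm (w (Suc k) - w k - h *\<^sub>R V (w k)) / h"
      using h by (simp add: divide_inverse mult.commute)
    also have "\<dots> \<le> e"
      using step[OF kn] h by (simp add: h_def field_simps)
    finally show ?thesis .
  qed
  moreover have "\<forall>\<^sub>F s in at_right 0. polygon t w n (\<tau> + s) = polygon t w n \<tau> + s *\<^sub>R v"
  proof -
    have "\<forall>\<^sub>F s in at_right 0. s \<in> {0<..<t (Suc k) - \<tau>}"
      using k by (intro eventually_at_right_real) auto
    then show ?thesis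
    proof eventually_elim
      case (elim s)
      then show ?case
        using k k' by (simp add: seg algebra_simps)
    qed
  qed
  ultimately show "\<exists>w'\<in>D. \<exists>v. norm (polygon t w n \<tau> - w') \<le> e \<and> norm (v - V w') \<le> e \<and>
        (\<forall>\<^sub>F s in at_right 0. polygon t w n (\<tau> + s) = polygon t w n \<tau> + s *\<^sub>R v)"
    using w[OF kn] by blast
qed

section \<open>Construction of approximate solutions\<close>

text \<open>Subtangency makes the distance to \<open>K\<close> strictly less than
  \<open>e * h\<close> for some small \<open>h\<close>. Strictness matters: the infimum need not be
  attained, yet some point of \<open>K\<close> beats the bound.\<close>

lemma euler_step_exists:
  fixes V :: "'a::real_normed_vector \<Rightarrow> 'a"
  assumes w: "w \<in> K"
    and sub: "((\<lambda>s. infdist (w + s *\<^sub>R V w) K / s) \<longlongrightarrow> 0) (at_right 0)"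
    and pos: "e > 0" "d > 0"
  obtains h z where "0 < h" "h < d" "z \<in> K" "norm (z - w - h *\<^sub>R V w) < e * h"
proof -
  have "\<forall>\<^sub>F s in at_right 0. infdist (w + s *\<^sub>R V w) K / s < e"
    using order_tendstoD(2)[OF sub \<open>e > 0\<close>] .
  moreover have "\<forall>\<^sub>F s in at_right 0. s \<in> {0<..<d}"
    using pos by (intro eventually_at_right_real) auto
  ultimately have "\<forall>\<^sub>F s in at_right (0::real). s \<in> {0<..<d} \<and> infdist (w + s *\<^sub>R V w) K / s < e"
    by eventually_elim simp
  then obtain h where "h \<in> {0<..<d} \<and> infdist (w + h *\<^sub>R V w) K / h < e"
    using eventually_happens'[OF trivial_limit_at_right_real] by blast
  then have h: "0 < h" "h < d" "infdist (w + h *\<^sub>R V w) K / h < e"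
    by simp_all
  then have "infdist (w + h *\<^sub>R V w) K < e * h"
    by (simp add: pos_divide_less_eq)
  \<comment> \<open>\<open>infdist\<close> is this infimum only for nonempty sets, being 0 by
    convention otherwise; the point \<open>w\<close> shows that \<open>K\<close> is
    nonempty.\<close>
  then have "(INF z\<in>K. dist (w + h *\<^sub>R V w) z) < e * h"
    using w by (subst (asm) infdist_notempty) auto
  then obtain z where "z \<in> K" "dist (w + h *\<^sub>R V w) z < e * h"
    using cINF_less_iff[OF _ bdd_below_image_dist] w by blast
  moreover have "norm (z - w - h *\<^sub>R V w) = dist (w + h *\<^sub>R V w) z"
    unfolding dist_norm by (subst norm_minus_commute) (simp add: algebra_simps)
  ultimately show ?thesis
    using h(1,2) by (intro that[of h z]) simp_all
qed

text \<open>Nodes move at speed at most \<open>M + 1\<close>, so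
  \<open>(M + 1) * R \<le> \<rho>\<close> keeps them in the ball up to time \<open>R\<close>. The
  gap \<open>r < R\<close> ensures that, if the times never reached \<open>r\<close>, a step of
  positive length would still be admissible at their limit.\<close>

lemma approx_solution_exists:
  fixes V :: "'a::real_normed_vector \<Rightarrow> 'a" and K :: "'a set" and u :: 'a and \<rho> :: real
  defines "D \<equiv> K \<inter> cball u \<rho>"
  assumes u: "u \<in> K" and compl: "complete D"
    and L: "L-lipschitz_on D V"
    and sub: "\<And>w. w \<in> D \<Longrightarrow> ((\<lambda>s. infdist (w + s *\<^sub>R V w) K / s) \<longlongrightarrow> 0) (at_right 0)"
    and M: "\<And>w. w \<in> D \<Longrightarrow> norm (V w) \<le> M" and M0: "M \<ge> 0"
    and r: "0 \<le> r" "r < R" "(M + 1) * R \<le> \<rho>" and e: "e > 0"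
  obtains p where "approx_solution V D r e p" "p 0 = u"
proof -
  have L0: "L \<ge> 0"
    using L by (rule lipschitz_on_nonneg)
  have R0: "R > 0"
    using r by simp
  \<comment> \<open>The bound 1 limits the speed of a corrected step to \<open>M + 1\<close>. The
    bound \<open>e / (M + 1)\<close> makes a step of duration at most \<epsilon> cover a distance of
    at most \<open>e\<close>.\<close>
  define \<epsilon> where "\<epsilon> = min 1 (e / (M + 1))"
  have "\<epsilon> \<le> e / (M + 1)" and \<epsilon>: "0 < \<epsilon>" "\<epsilon> \<le> 1"
    using e M0 by (auto simp: \<epsilon>_def)
  then have \<epsilon>M: "\<epsilon> * (M + 1) \<le> e"
    using M0 by (simp add: pos_le_divide_eq)
  have \<epsilon>e: "\<epsilon> \<le> e"
    using \<epsilon>M mult_nonneg_nonneg[of \<epsilon> M] \<epsilon> M0 unfolding distrib_left by linarith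
  define step where "step t w h z \<longleftrightarrow> 0 < h \<and> h \<le> \<epsilon> \<and> t + h < R \<and> z \<in> K \<and>
    norm (z - w - h *\<^sub>R V w) \<le> \<epsilon> * h" for t w h z
  define valid where "valid x \<longleftrightarrow> 0 \<le> fst x \<and> fst x < R \<and> snd x \<in> K \<and>
    norm (snd x - u) \<le> (M + 1) * fst x" for x :: "real \<times> 'a"
  have inD: "snd x \<in> D" if "valid x" for x
  proof -
    have "(M + 1) * fst x \<le> (M + 1) * R"
      using that M0 by (intro mult_left_mono) (auto simp: valid_def)
    then show ?thesis
      using that r by (auto simp: valid_def D_def dist_norm norm_minus_commute)
  qed
  have step_len: "norm (z - w) \<le> (M + 1) * h" if "step t w h z" "w \<in> D" for t w h z
  proof -
    have "norm (z - w) \<le> norm (z - w - h *\<^sub>R V w) + norm (h *\<^sub>R V w)"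
      by (metis add.commute norm_triangle_sub)
    also have "norm (h *\<^sub>R V w) \<le> h * M"
      using that M by (simp add: step_def)
    also have "norm (z - w - h *\<^sub>R V w) \<le> 1 * h"
    proof -
      have "\<epsilon> * h \<le> 1 * h"
        using that \<epsilon> by (intro mult_right_mono) (auto simp: step_def)
      then show ?thesis using that unfolding step_def by linarith
    qed
    finally show ?thesis by (simp add: algebra_simps)
  qed
  \<comment> \<open>The supremum of the admissible step lengths need not be attained, so the step
    taken is only required to be at least half of every admissible one.\<close>
  define advance where "advance x y \<longleftrightarrow> step (fst x) (snd x) (fst y - fst x) (snd y) \<and>
    (\<forall>h z. step (fst x) (snd x) h z \<longrightarrow> h \<le> 2 * (fst y - fst x))" for x y
  \<comment> \<open>The clause for \<open>n = 0\<close> fixes the starting point within the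
    dependent choice.\<close>
  have "\<exists>f. \<forall>n. (valid (f n) \<and> (n = 0 \<longrightarrow> f n = (0, u))) \<and> advance (f n) (f (Suc n))"
  proof (rule dependent_nat_choice)
    show "\<exists>x. valid x \<and> (0 = (0::nat) \<longrightarrow> x = (0, u))"
      using u R0 by (auto simp: valid_def)
    fix x and n :: nat
    assume "valid x \<and> (n = 0 \<longrightarrow> x = (0, u))"
    then have x: "valid x" ..
    define H where "H = {h. \<exists>z. step (fst x) (snd x) h z}"
    have "R - fst x > 0"
      using x by (simp add: valid_def)
    then obtain h z where "0 < h" "h < min \<epsilon> (R - fst x)" "z \<in> K"
      "norm (z - snd x - h *\<^sub>R V (snd x)) < \<epsilon> * h"
      using euler_step_exists[of "snd x" K V \<epsilon> "min \<epsilon> (R - fst x)"] sub[OF inD[OF x]] \<epsilon> x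
      by (auto simp: valid_def)
    then have hH: "h \<in> H" and h0: "h > 0"
      by (auto simp: H_def step_def)
    have bdd: "bdd_above H"
      by (rule bdd_aboveI[of _ \<epsilon>]) (auto simp: H_def step_def)
    have "Sup H \<ge> h"
      using hH bdd by (rule cSup_upper)
    then have "Sup H / 2 < Sup H"
      using h0 by simp
    then obtain h' where h': "h' \<in> H" "Sup H / 2 < h'"
      using less_cSup_iff[OF _ bdd] hH by blast
    then obtain z' where z': "step (fst x) (snd x) h' z'"
      by (auto simp: H_def)
    define y where "y = (fst x + h', z')"
    have "norm (z' - u) \<le> (M + 1) * h' + (M + 1) * fst x"
      by (rule norm_diff_triangle_le[OF step_len[OF z' inD[OF x]]]) (use x in \<open>simp add: valid_def\<close>)
    then have "valid y"
      using z' x by (auto simp: valid_def y_def step_def algebra_simps)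
    moreover have "advance x y"
      unfolding advance_def
    proof (intro conjI allI impI)
      show "step (fst x) (snd x) (fst y - fst x) (snd y)"
        using z' by (simp add: y_def)
      fix h z assume "step (fst x) (snd x) h z"
      then have "h \<le> Sup H"
        by (intro cSup_upper bdd) (auto simp: H_def)
      then show "h \<le> 2 * (fst y - fst x)"
        using h'(2) by (simp add: y_def)
    qed
    ultimately show "\<exists>y. (valid y \<and> (Suc n = 0 \<longrightarrow> y = (0, u))) \<and> advance x y"
      by blast
  qed
  then obtain f where valid: "\<And>n. valid (f n)" and f0: "f 0 = (0, u)"
    and nxt: "\<And>n. advance (f n) (f (Suc n))"
    by auto
  define t where "t n = fst (f n)" for n
  define w where "w n = snd (f n)" for n
  have t0: "t 0 = 0" and w0: "w 0 = u"
    by (auto simp: t_def w_def f0)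
  have tR: "0 \<le> t n" "t n < R" for n
    using valid[of n] by (auto simp: valid_def t_def)
  have wD: "w n \<in> D" for n
    using inD[OF valid[of n]] by (simp add: w_def)
  have stp: "step (t n) (w n) (t (Suc n) - t n) (w (Suc n))" for n
    using nxt[of n] by (simp add: advance_def t_def w_def)
  have best: "h \<le> 2 * (t (Suc n) - t n)" if "step (t n) (w n) h z" for n h z
    using nxt[of n] that unfolding advance_def t_def w_def by blast
  have t_mono: "strict_mono t"
    using stp by (simp add: strict_mono_Suc_iff step_def)
  have "\<exists>n. r \<le> t n"
  proof (rule ccontr)
    assume "\<not> (\<exists>n. r \<le> t n)"
    then have tr: "t n \<le> r" for n
      by (meson less_imp_le not_le)
    have "convergent t"
      using t_mono tr tR
      by (intro Bseq_monoseq_convergent) (auto simp: monoseq_def strict_mono_less_eq intro!: BseqI'[of _ r])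
    then obtain T where T: "t \<longlonglongrightarrow> T"
      by (auto simp: convergent_def)
    have TR: "T < R"
      using LIMSEQ_le_const2[OF T, of r] tr r by force
    have tT: "t n \<le> T" for n
      using T t_mono by (intro incseq_le) (auto simp: strict_mono_mono)
    \<comment> \<open>The speed bound carries the Cauchy property from the times over to the
      nodes.\<close>
    have wdiff: "norm (w n - w m) \<le> (M + 1) * (t n - t m)" if "m \<le> n" for m n
      using that
    proof (induction n rule: dec_induct)
      case (step n)
      have "norm (w (Suc n) - w m) \<le> (M + 1) * (t (Suc n) - t n) + (M + 1) * (t n - t m)"
        by (rule norm_diff_triangle_le[OF step_len[OF stp wD] step.IH])
      then show ?case by (simp add: algebra_simps)
    qed simp
    have "Cauchy w"
    proof (rule metric_CauchyI)
      fix d :: real assume d: "d > 0"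
      have "Cauchy t"
        using T by (intro convergent_Cauchy) (auto simp: convergent_def)
      then obtain N where N: "\<And>m n. m \<ge> N \<Longrightarrow> n \<ge> N \<Longrightarrow> dist (t m) (t n) < d / (M + 1)"
        using metric_CauchyD[of t "d / (M + 1)"] d M0 by auto
      have *: "norm (w n - w m) < d" if "N \<le> m" "m \<le> n" for m n
      proof -
        have "t n - t m < d / (M + 1)"
          using N[of n m] that by (simp add: dist_real_def)
        then have "(M + 1) * (t n - t m) < d"
          using M0 by (simp add: field_simps)
        with wdiff[OF that(2)] show ?thesis by simp
      qed
      have "dist (w m) (w n) < d" if "N \<le> m" "N \<le> n" for m n
        using *[of m n] *[of n m] that by (cases "m \<le> n") (auto simp: dist_norm norm_minus_commute)
      then show "\<exists>N. \<forall>m\<ge>N. \<forall>n\<ge>N. dist (w m) (w n) < d"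
        by blast
    qed
    then obtain W where W: "W \<in> D" "w \<longlonglongrightarrow> W"
      using compl wD unfolding complete_def by blast
    \<comment> \<open>A step from the limit node \<open>W\<close> to \<open>z\<close>. With
      \<open>h\<close> and \<open>z\<close> fixed, its strict error bound persists with
      \<open>w n\<close> in place of \<open>W\<close> for late \<open>n\<close>, and
      \<open>t n + h \<le> T + h < R\<close>. So \<open>h\<close> is admissible there and
      \<open>best\<close> gives \<open>t (Suc n) - t n \<ge> h / 2\<close>, although these
      differences tend to 0.\<close>
    obtain h z where h: "0 < h" "h < min \<epsilon> (R - T)" "z \<in> K"
      "norm (z - W - h *\<^sub>R V W) < \<epsilon> * h"
      using euler_step_exists[of W K V \<epsilon> "min \<epsilon> (R - T)"] sub[OF W(1)] \<epsilon> TR W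
      by (auto simp: D_def)
    have "continuous_on D V"
      using L by (rule lipschitz_on_continuous_on)
    then have "(\<lambda>n. V (w n)) \<longlonglongrightarrow> V W"
      using W wD by (intro continuous_on_tendsto_compose[of "D" V]) auto
    then have "(\<lambda>n. norm (z - w n - h *\<^sub>R V (w n))) \<longlonglongrightarrow> norm (z - W - h *\<^sub>R V W)"
      using W by (intro tendsto_intros)
    then have "\<forall>\<^sub>F n in sequentially. norm (z - w n - h *\<^sub>R V (w n)) < \<epsilon> * h"
      using h(4) by (rule order_tendstoD)
    moreover have "(\<lambda>n. t (Suc n) - t n) \<longlonglongrightarrow> T - T"
      using T by (intro tendsto_intros LIMSEQ_Suc)
    then have "\<forall>\<^sub>F n in sequentially. t (Suc n) - t n < h / 2"
      by (rule order_tendstoD) (use h in simp)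
    ultimately have "\<forall>\<^sub>F n in sequentially. False"
    proof eventually_elim
      case (elim n)
      have "step (t n) (w n) h z"
        using h elim tT[of n] by (auto simp: step_def)
      from best[OF this] elim show ?case by simp
    qed
    then show False by simp
  qed
  then obtain n where n: "r \<le> t n" ..
  \<comment> \<open>\<open>Suc n\<close> segments guarantee at least one, as
    \<open>polygon_start\<close> demands; \<open>n\<close> may be 0 when
    \<open>r = 0\<close>.\<close>
  have "approx_solution V D r e (polygon t w (Suc n))"
  proof (rule polygon_approx_solution[OF t_mono t0])
    show "r \<le> t (Suc n)"
      using n t_mono by (smt (verit) strict_mono_Suc_iff)
    fix k
    show "w k \<in> D"
      by (rule wD)
    have "\<epsilon> * (t (Suc k) - t k) \<le> e * (t (Suc k) - t k)"
      using stp[of k] \<epsilon>e by (intro mult_right_mono) (auto simp: step_def)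
    then show "norm (w (Suc k) - w k - (t (Suc k) - t k) *\<^sub>R V (w k)) \<le> e * (t (Suc k) - t k)"
      using stp[of k] unfolding step_def by linarith
    have "(M + 1) * (t (Suc k) - t k) \<le> (M + 1) * \<epsilon>"
      using stp[of k] M0 by (intro mult_left_mono) (auto simp: step_def)
    then show "norm (w (Suc k) - w k) \<le> e"
      using step_len[OF stp wD, of k] \<epsilon>M by (simp add: mult.commute)
  qed
  moreover have "polygon t w (Suc n) 0 = u"
    using polygon_start[OF t_mono, of "Suc n" w] by (simp add: t0 w0)
  ultimately show ?thesis
    using that by blast
qed

section \<open>Passage to the limit\<close>

text \<open>Completeness is local, in \<open>D\<close>, whereas subtangency measures the distance to
  all of \<open>K\<close>: corrected steps land in \<open>K\<close>, and the speed bound keeps them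
  in the ball for a short time.\<close>

theorem nagumo_local:
  fixes V :: "'a::real_normed_vector \<Rightarrow> 'a" and K :: "'a set" and u :: 'a and \<rho> :: real
  defines "D \<equiv> K \<inter> cball u \<rho>"
  assumes u: "u \<in> K" and \<rho>: "\<rho> > 0" and compl: "complete D"
    and L: "L-lipschitz_on D V"
    and sub: "\<And>w. w \<in> D \<Longrightarrow> ((\<lambda>s. infdist (w + s *\<^sub>R V w) K / s) \<longlongrightarrow> 0) (at_right 0)"
  obtains r \<eta> where "r > 0" "\<eta> 0 = u" "\<And>t. t \<in> {0..<r} \<Longrightarrow> \<eta> t \<in> D"
    "\<And>t. t \<in> {0..<r} \<Longrightarrow> (\<eta> has_vector_derivative V (\<eta> t)) (at t within {0..<r})"
proof -
  have L0: "L \<ge> 0"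
    using L by (rule lipschitz_on_nonneg)
  have uD: "u \<in> D"
    using u \<rho> by (simp add: D_def)
  have near_u: "norm (w - u) \<le> \<rho>" if "w \<in> D" for w
    using that by (simp add: D_def dist_norm norm_minus_commute)
  define M where "M = norm (V u) + L * \<rho>"
  have M0: "M \<ge> 0"
    using L0 \<rho> by (simp add: M_def)
  have M: "norm (V w) \<le> M" if "w \<in> D" for w
  proof -
    have "norm (V w - V u) \<le> L * norm (w - u)"
      using lipschitz_onD[OF L that uD] by (simp add: dist_norm)
    also have "\<dots> \<le> L * \<rho>"
      using near_u[OF that] L0 by (rule mult_left_mono)
    finally show ?thesis
      using norm_triangle_sub[of "V w" "V u"] by (simp add: M_def)
  qed
  \<comment> \<open>The first entry keeps the nodes in the ball, the second makes
    \<open>L * r \<le> 1/2\<close>. Halving \<open>R\<close> to get \<open>r\<close> provides the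
    strict gap needed for the construction of the polygons.\<close>
  define R where "R = min (\<rho> / (M + 1)) (1 / (2 * (L + 1)))"
  have R0: "R > 0"
    using \<rho> M0 L0 by (simp add: R_def)
  have "R \<le> \<rho> / (M + 1)" "R \<le> 1 / (2 * (L + 1))"
    by (simp_all add: R_def)
  then have R: "(M + 1) * R \<le> \<rho>" "2 * (L + 1) * R \<le> 1"
    using M0 L0 by (simp_all add: pos_le_divide_eq mult.commute)
  define r where "r = R / 2"
  have r: "r > 0" "r < R"
    using R0 by (simp_all add: r_def)
  have Lr: "L * r \<le> 1/2"
    using R(2) L0 R0 by (simp add: r_def algebra_simps)
  define e where "e n = inverse (real (Suc n))" for n
  have e: "0 < e n" "e n \<le> 1" for n
    by (simp_all add: e_def field_simps)
  have e_lim: "e \<longlonglongrightarrow> 0"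
    unfolding e_def by (rule LIMSEQ_inverse_real_of_nat)
  have "\<exists>p. approx_solution V D r (e n) p \<and> p 0 = u" for n
    by (rule approx_solution_exists[of u K \<rho> L V M r R "e n", folded D_def])
      (use u compl L sub M M0 R r e in auto)
  then obtain p where p: "\<And>n. approx_solution V D r (e n) (p n)" and p0: "\<And>n. p n 0 = u"
    by metis
  define C where "C = 2 * (1 + L) * r"
  have C0: "C \<ge> 0"
    using L0 r by (simp add: C_def)
  have close: "norm (p m t - p n t) \<le> C * (e m + e n)" if "t \<in> {0..<r}" for m n t
  proof -
    have "norm (p m t - p n t) \<le> 2 * (1 + L) * (e m + e n) * t"
      using that e[of m] e[of n] p0
      by (intro approx_solutions_close[OF p p L Lr]) auto
    also have "\<dots> \<le> 2 * (1 + L) * (e m + e n) * r"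
      using that e[of m] e[of n] L0 by (intro mult_left_mono) auto
    finally show ?thesis
      by (simp add: C_def mult_ac)
  qed
  \<comment> \<open>Points of a polygon between nodes may lie outside \<open>D\<close>. The limit is
    therefore found for nearby nodes, which are in \<open>D\<close> and within \<open>e n\<close> of
    \<open>p n t\<close>, and then transferred.\<close>
  have "\<exists>y\<in>D. (\<lambda>n. p n t) \<longlonglongrightarrow> y" if t: "t \<in> {0..<r}" for t
  proof -
    have "\<exists>w\<in>D. norm (p n t - w) \<le> e n" for n
      by (rule approx_solutionE[OF p, of t n]) (use t in auto)
    then obtain w where w: "\<And>n. w n \<in> D" "\<And>n. norm (p n t - w n) \<le> e n"
      by metis
    have ww: "norm (w m - w n) \<le> (C + 1) * e m + (C + 1) * e n" for m n
    proof -
      have "norm (w m - p n t) \<le> e m + C * (e m + e n)"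
        by (rule norm_diff_triangle_le[of _ "p m t"]) (use w close[OF t] in \<open>auto simp: norm_minus_commute\<close>)
      then have "norm (w m - w n) \<le> e m + C * (e m + e n) + e n"
        using w(2) by (rule norm_diff_triangle_le)
      then show ?thesis
        by (simp add: algebra_simps)
    qed
    have "Cauchy w"
    proof (rule metric_CauchyI)
      fix d :: real assume d: "d > 0"
      have "(\<lambda>n. (C + 1) * e n) \<longlonglongrightarrow> (C + 1) * 0"
        by (intro tendsto_intros e_lim)
      then have "\<forall>\<^sub>F n in sequentially. (C + 1) * e n < d / 2"
        by (rule order_tendstoD) (use d in simp)
      then obtain N where N: "\<And>n. n \<ge> N \<Longrightarrow> (C + 1) * e n < d / 2"
        by (auto simp: eventually_sequentially)
      have "dist (w m) (w n) < d" if "N \<le> m" "N \<le> n" for m n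
        using ww[of m n] N[OF that(1)] N[OF that(2)] unfolding dist_norm by linarith
      then show "\<exists>N. \<forall>m\<ge>N. \<forall>n\<ge>N. dist (w m) (w n) < d"
        by blast
    qed
    then obtain y where y: "y \<in> D" "w \<longlonglongrightarrow> y"
      using compl w(1) unfolding complete_def by blast
    have "(\<lambda>n. p n t - w n) \<longlonglongrightarrow> 0"
      using w(2) by (intro tendsto_0_le[OF e_lim, of _ 1]) (auto simp: e less_imp_le)
    from tendsto_add[OF this y(2)] have "(\<lambda>n. p n t) \<longlonglongrightarrow> y"
      by simp
    with y(1) show ?thesis
      by blast
  qed
  then obtain \<eta> where \<eta>D: "\<And>t. t \<in> {0..<r} \<Longrightarrow> \<eta> t \<in> D"
    and \<eta>_lim: "\<And>t. t \<in> {0..<r} \<Longrightarrow> (\<lambda>n. p n t) \<longlonglongrightarrow> \<eta> t"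
    by metis
  have \<eta>0: "\<eta> 0 = u"
    using \<eta>_lim[of 0] r by (simp add: p0 LIMSEQ_const_iff)
  have p\<eta>: "norm (p n t - \<eta> t) \<le> C * e n" if "t \<in> {0..<r}" for n t
  proof (rule LIMSEQ_le)
    show "(\<lambda>m. norm (p n t - p m t)) \<longlonglongrightarrow> norm (p n t - \<eta> t)"
      by (intro tendsto_intros \<eta>_lim that)
    have "(\<lambda>m. C * (e n + e m)) \<longlonglongrightarrow> C * (e n + 0)"
      by (intro tendsto_intros e_lim)
    then show "(\<lambda>m. C * (e n + e m)) \<longlonglongrightarrow> C * e n"
      by simp
  qed (use close[OF that] in auto)
  \<comment> \<open>A Lipschitz constant for all polygons: \<open>M\<close> bounds the norm of
    \<open>V u\<close>, and the rest is the error of \<open>approx_solution_near_line\<close> at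
    \<open>z = u\<close> with \<open>e n \<le> 1\<close> and distance at most
    \<open>1 + \<rho>\<close> from \<open>u\<close>.\<close>
  define N where "N = M + (1 + L * (1 + (1 + \<rho>)))"
  have N0: "N \<ge> 0"
    using M0 L0 \<rho> by (simp add: N_def)
  have p_lip: "norm (p n b - p n a) \<le> N * (b - a)" if ab: "0 \<le> a" "a \<le> b" "b < r" for n a b
  proof -
    have "norm (p n \<tau> - u) \<le> 1 + \<rho>" if \<tau>: "a \<le> \<tau>" "\<tau> < b" for \<tau>
    proof -
      obtain w where "w \<in> D" "norm (p n \<tau> - w) \<le> e n"
        by (rule approx_solutionE[OF p, of \<tau> n]) (use ab \<tau> in auto)
      then show ?thesis
        using norm_diff_triangle_le[of "p n \<tau>" w 1 u \<rho>] near_u e(2)[of n] by simp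
    qed
    then have "norm (p n b - p n a - (b - a) *\<^sub>R V u) \<le> (e n + L * (e n + (1 + \<rho>))) * (b - a)"
      using ab by (intro approx_solution_near_line[OF p L uD]) auto
    also have "\<dots> \<le> (1 + L * (1 + (1 + \<rho>))) * (b - a)"
      using ab e(2)[of n] L0 by (intro mult_right_mono add_mono mult_left_mono) auto
    finally have "norm (p n b - p n a - (b - a) *\<^sub>R V u) \<le> (1 + L * (1 + (1 + \<rho>))) * (b - a)" .
    moreover have "norm ((b - a) *\<^sub>R V u) \<le> M * (b - a)"
      using mult_right_mono[OF M[OF uD], of "b - a"] ab by (simp add: mult.commute)
    ultimately show ?thesis
      using norm_triangle_sub[of "p n b - p n a" "(b - a) *\<^sub>R V u"]
      unfolding N_def distrib_right by linarith
  qed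
  have \<eta>_lip: "norm (\<eta> b - \<eta> a) \<le> N * (b - a)" if ab: "0 \<le> a" "a \<le> b" "b < r" for a b
  proof (rule LIMSEQ_le_const2)
    show "(\<lambda>n. norm (p n b - p n a)) \<longlonglongrightarrow> norm (\<eta> b - \<eta> a)"
      using ab by (intro tendsto_intros \<eta>_lim) auto
  qed (use p_lip[OF ab] in auto)
  \<comment> \<open>On the interval \<open>p n\<close> stays within
    \<open>C * e n + N * (b - a)\<close> of \<open>\<eta> t\<close>, so the comparison with the line
    of slope \<open>V (\<eta> t)\<close> leaves a quadratic error as \<open>n\<close> grows. Letting
    \<open>t\<close> be either endpoint covers both one-sided derivatives.\<close>
  have quadratic: "norm (\<eta> b - \<eta> a - (b - a) *\<^sub>R V (\<eta> t)) \<le> L * N * (b - a) * (b - a)"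
    if ab: "0 \<le> a" "a \<le> b" "b < r" and t: "t = a \<or> t = b" for a b t
  proof (rule LIMSEQ_le)
    have t': "t \<in> {0..<r}"
      using ab t by auto
    show "(\<lambda>n. norm (p n b - p n a - (b - a) *\<^sub>R V (\<eta> t))) \<longlonglongrightarrow>
        norm (\<eta> b - \<eta> a - (b - a) *\<^sub>R V (\<eta> t))"
      using ab by (intro tendsto_intros \<eta>_lim) auto
    have "(\<lambda>n. (e n + L * (e n + (C * e n + N * (b - a)))) * (b - a)) \<longlonglongrightarrow>
        (0 + L * (0 + (C * 0 + N * (b - a)))) * (b - a)"
      by (intro tendsto_intros e_lim)
    then show "(\<lambda>n. (e n + L * (e n + (C * e n + N * (b - a)))) * (b - a)) \<longlonglongrightarrow>
        L * N * (b - a) * (b - a)"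
      by (simp add: mult.assoc)
    have near: "norm (p n \<tau> - \<eta> t) \<le> C * e n + N * (b - a)" if \<tau>: "a \<le> \<tau>" "\<tau> < b" for n \<tau>
    proof (rule norm_diff_triangle_le)
      show "norm (p n \<tau> - \<eta> \<tau>) \<le> C * e n"
        using ab \<tau> by (intro p\<eta>) auto
      have "norm (\<eta> \<tau> - \<eta> t) \<le> N * \<bar>\<tau> - t\<bar>"
        using t \<eta>_lip[of a \<tau>] \<eta>_lip[of \<tau> b] ab \<tau> by (auto simp: norm_minus_commute)
      also have "\<dots> \<le> N * (b - a)"
        using t \<tau> N0 by (intro mult_left_mono) auto
      finally show "norm (\<eta> \<tau> - \<eta> t) \<le> N * (b - a)" .
    qed
    show "\<exists>k. \<forall>n\<ge>k. norm (p n b - p n a - (b - a) *\<^sub>R V (\<eta> t)) \<le>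
        (e n + L * (e n + (C * e n + N * (b - a)))) * (b - a)"
      using ab near by (intro exI allI impI approx_solution_near_line[OF p L \<eta>D[OF t']]) auto
  qed
  show ?thesis
  proof (rule that[of r \<eta>, OF r(1) \<eta>0 \<eta>D])
    fix t assume t: "t \<in> {0..<r}"
    have LN: "L * N \<ge> 0"
      using L0 N0 by simp
    show "(\<eta> has_vector_derivative V (\<eta> t)) (at t within {0..<r})"
      unfolding has_vector_derivative_def has_derivative_within_alt
    proof (intro conjI allI impI)
      show "bounded_linear (\<lambda>x. x *\<^sub>R V (\<eta> t))"
        by (rule bounded_linear_scaleR_left)
      fix \<epsilon> :: real assume \<epsilon>: "\<epsilon> > 0"
      \<comment> \<open>Adding 1 to \<open>L * N\<close> keeps the radius well defined when that
        product is zero.\<close>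
      have "norm (\<eta> y - \<eta> t - (y - t) *\<^sub>R V (\<eta> t)) \<le> \<epsilon> * norm (y - t)"
        if y: "y \<in> {0..<r}" "norm (y - t) < \<epsilon> / (L * N + 1)" for y
      proof -
        have "norm (\<eta> y - \<eta> t - (y - t) *\<^sub>R V (\<eta> t)) \<le> L * N * \<bar>y - t\<bar> * \<bar>y - t\<bar>"
        proof (cases "t \<le> y")
          case True
          then show ?thesis
            using quadratic[of t y t] t y by simp
        next
          case False
          have "\<eta> y - \<eta> t - (y - t) *\<^sub>R V (\<eta> t) = - (\<eta> t - \<eta> y - (t - y) *\<^sub>R V (\<eta> t))"
            by (simp add: algebra_simps)
          then have "norm (\<eta> y - \<eta> t - (y - t) *\<^sub>R V (\<eta> t)) = norm (\<eta> t - \<eta> y - (t - y) *\<^sub>R V (\<eta> t))"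
            by (simp only: norm_minus_cancel)
          then show ?thesis
            using quadratic[of y t t] t y False by (simp add: abs_real_def)
        qed
        also have "\<dots> \<le> \<epsilon> * \<bar>y - t\<bar>"
        proof (rule mult_right_mono)
          have "(L * N + 1) * \<bar>y - t\<bar> < \<epsilon>"
            using y(2) LN by (simp add: pos_less_divide_eq mult.commute)
          then show "L * N * \<bar>y - t\<bar> \<le> \<epsilon>"
            by (simp add: distrib_right)
        qed simp
        finally show ?thesis by simp
      qed
      moreover have "\<epsilon> / (L * N + 1) > 0"
        using \<epsilon> LN by simp
      ultimately show "\<exists>d>0. \<forall>y\<in>{0..<r}. norm (y - t) < d \<longrightarrow>
          norm (\<eta> y - \<eta> t - (y - t) *\<^sub>R V (\<eta> t)) \<le> \<epsilon> * norm (y - t)"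
        by blast
    qed
  qed
qed

section \<open>Application to the product of spheres\<close>

lemma closed_sphere_product: "closed (sphere_product \<iota> c)"
  unfolding sphere_product_def
  by (intro closed_Collect_all closed_Collect_eq continuous_intros)

theorem proposition3p2:
  fixes \<iota> :: "'e::{real_inner,complete_space} \<Rightarrow>\<^sub>L 'h::{real_inner,complete_space}"
    and c :: "real ^ 'm"
    and u :: "'e ^ 'm"
    and B U clU :: "('e ^ 'm) set"
    and V :: "'e ^ 'm \<Rightarrow> 'e ^ 'm"
  defines "clU \<equiv> top_of_set (sphere_product \<iota> c) closure_of U"
  assumes triple: "hilbert_triple \<iota>"
    and c_pos: "\<forall>j. c $ j > 0"
    and u_in_B: "u \<in> B"
    and B_sub: "B \<subseteq> sphere_product \<iota> c"
    and U_sub: "U \<subseteq> sphere_product \<iota> c"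
    and U_nbhd: "\<exists>W. openin (top_of_set (sphere_product \<iota> c)) W \<and> u \<in> W \<and> W \<subseteq> U"
    and closed: "closedin (top_of_set (sphere_product \<iota> c)) (B \<inter> clU)"
    and V_lipschitz: "\<exists>L. L-lipschitz_on clU V"
    and V_tangent: "\<forall>w\<in>clU. V w \<in> tangent_space \<iota> w"
    and V_subtangent:
      "\<forall>w\<in>clU \<inter> B. ((\<lambda>s. infdist (w + s *\<^sub>R V w) B / s) \<longlongrightarrow> 0) (at_right 0)"
  shows "\<exists>r>0. \<exists>\<eta> :: real \<Rightarrow> 'e ^ 'm.
           \<eta> 0 = u \<and>
           (\<forall>t\<in>{0..<r}. \<eta> t \<in> clU \<and>
              (\<eta> has_vector_derivative V (\<eta> t)) (at t within {0..<r}) \<and>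
              \<eta> t \<in> B)"
proof -
  let ?S = "sphere_product \<iota> c"
  obtain W T where W: "W \<subseteq> U" "u \<in> W" "open T" "W = ?S \<inter> T"
    using U_nbhd by (auto simp: openin_open)
  \<comment> \<open>A ball inside \<open>T\<close> meets \<open>B\<close> only within
    \<open>W\<close>, hence within \<open>U\<close> and its relative closure, where all assumptions
    on \<open>V\<close> are available.\<close>
  then obtain \<rho> where \<rho>: "\<rho> > 0" "cball u \<rho> \<subseteq> T"
    using open_contains_cball by blast
  have "U \<subseteq> clU"
    unfolding clU_def using U_sub by (intro closure_of_subset) simp
  then have sub: "B \<inter> cball u \<rho> \<subseteq> clU"
    using W \<rho> B_sub by blast
  \<comment> \<open>The product of spheres is closed in the whole space, so relative closedness is
    absolute and yields completeness of the part of \<open>B\<close> in the ball.\<close>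
  have "closed (B \<inter> clU)"
    using closed closed_sphere_product by (rule closedin_closed_trans)
  moreover have "B \<inter> cball u \<rho> = (B \<inter> clU) \<inter> cball u \<rho>"
    using sub by blast
  ultimately have compl: "complete (B \<inter> cball u \<rho>)"
    by (simp add: complete_eq_closed closed_Int)
  obtain L where "L-lipschitz_on clU V"
    using V_lipschitz by blast
  then have "L-lipschitz_on (B \<inter> cball u \<rho>) V"
    using sub by (rule lipschitz_on_subset)
  then obtain r \<eta> where "r > 0" "\<eta> 0 = u" "\<And>t. t \<in> {0..<r} \<Longrightarrow> \<eta> t \<in> B \<inter> cball u \<rho>"
    "\<And>t. t \<in> {0..<r} \<Longrightarrow> (\<eta> has_vector_derivative V (\<eta> t)) (at t within {0..<r})"
    using V_subtangent sub by (elim nagumo_local[OF u_in_B \<rho>(1) compl]) auto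
  then show ?thesis
    using sub by blast
qed

end
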